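(* Let $L\subseteq\mathbb{R}^3$ be a square pyramid, i.e. the convex hull of a (nondegenerate) planar square together with a point lying above (off the plane of the square, on the line perpendicular to it through) the center of the square. Then $L$ is $2$-reliable, but $L$ is not $2$-decomposable.
   Context: All compact convex sets are nonempty. For a linear subspace $\xi$ of $\mathbb{R}^3$, $K_\xi$ denotes the orthogonal projection of $K$ onto $\xi$. A compact convex set $L\subseteq\mathbb{R}^3$ is $2$-reliable if, for every compact convex $K\subseteq\mathbb{R}^3$ such that $L_\xi$ contains a translate of $K_\xi$ for every $2$-dimensional linear subspace $\xi\subseteq\mathbb{R}^3$, the set $L$ contains a translate of $K$. The set $L$ is $2$-decomposable if there exist a direct sum decomposition into linear subspaces $\mathbb{R}^3=\xi_1\oplus\cdots\oplus\xi_m$ with $\dim\xi_i\le2$ for each $i$, and compact convex sets $L_i\subseteq\xi_i$, such that $L=L_1+\cdots+L_m$ (Minkowski sum). *)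

theory Defs
  imports "HOL-Analysis.Analysis"
begin

definition compact_convex :: "'a::euclidean_space set \<Rightarrow> bool" where
  "compact_convex K \<longleftrightarrow> compact K \<and> convex K \<and> K \<noteq> {}"

definition orth_proj :: "'a::euclidean_space set \<Rightarrow> 'a \<Rightarrow> 'a" where
  "orth_proj \<xi> x = (THE y. y \<in> \<xi> \<and> (\<forall>z\<in>\<xi>. orthogonal (x - y) z))"

lemma ex1_orth_proj:
  fixes \<xi> :: "'a::euclidean_space set"
  assumes "subspace \<xi>"
  shows "\<exists>!y. y \<in> \<xi> \<and> (\<forall>z\<in>\<xi>. orthogonal (x - y) z)"
proof -
  obtain y w where yw: "y \<in> span \<xi>" "\<And>z. z \<in> span \<xi> \<Longrightarrow> orthogonal w z" "x = y + w"
    using orthogonal_subspace_decomp_exists[of \<xi> x] by metis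
  have sp: "span \<xi> = \<xi>"
    using assms by simp
  show ?thesis
  proof (intro ex1I[of _ y] conjI)
    show "y \<in> \<xi>" "\<forall>z\<in>\<xi>. orthogonal (x - y) z"
      using yw sp by auto
  next
    fix y' assume y': "y' \<in> \<xi> \<and> (\<forall>z\<in>\<xi>. orthogonal (x - y') z)"
    then have "y' - y \<in> \<xi>"
      using yw sp assms by (auto intro: subspace_diff)
    then have "inner (x - y) (y' - y) = 0" "inner (x - y') (y' - y) = 0"
      using yw sp y' by (auto simp: orthogonal_def)
    then have "inner (y' - y) (y' - y) = 0"
      by (simp add: inner_diff_left)
    then show "y' = y"
      by simp
  qed
qed

definition contains_translate :: "'a::euclidean_space set \<Rightarrow> 'a set \<Rightarrow> bool" where
  "contains_translate A B \<longleftrightarrow> (\<exists>v. (\<lambda>x. v + x) ` B \<subseteq> A)"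

definition reliable :: "nat \<Rightarrow> 'a::euclidean_space set \<Rightarrow> bool" where
  "reliable d L \<longleftrightarrow> compact_convex L \<and>
    (\<forall>K. compact_convex K \<longrightarrow>
      (\<forall>\<xi>. subspace \<xi> \<and> dim \<xi> = d \<longrightarrow> contains_translate (orth_proj \<xi> ` L) (orth_proj \<xi> ` K)) \<longrightarrow>
      contains_translate L K)"

(* Internal direct sum of all of the ambient space; PiE makes the tuple of components a unique
   function, undefined outside {..<m}. *)
definition direct_sum_decomposition :: "nat \<Rightarrow> (nat \<Rightarrow> 'a::euclidean_space set) \<Rightarrow> bool" where
  "direct_sum_decomposition m \<xi> \<longleftrightarrow>
    (\<forall>i<m. subspace (\<xi> i)) \<and>
    (\<forall>x. \<exists>!f. f \<in> PiE {..<m} \<xi> \<and> x = (\<Sum>i<m. f i))"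

(* The sum of the sets M i is the Minkowski sum of HOL-Library.Set_Algebras. *)
definition decomposable :: "nat \<Rightarrow> 'a::euclidean_space set \<Rightarrow> bool" where
  "decomposable d L \<longleftrightarrow>
    (\<exists>m \<xi> M. direct_sum_decomposition m \<xi> \<and>
      (\<forall>i<m. dim (\<xi> i) \<le> d \<and> compact_convex (M i) \<and> M i \<subseteq> \<xi> i) \<and>
      L = (\<Sum>i<m. M i))"

(* S is a nondegenerate square with centre c: u and v are two adjacent sides, issuing from
   the vertex a. *)
definition square_with_center :: "'a::euclidean_space set \<Rightarrow> 'a \<Rightarrow> bool" where
  "square_with_center S c \<longleftrightarrow>
    (\<exists>a u v. u \<noteq> 0 \<and> norm u = norm v \<and> orthogonal u v \<and>
      S = convex hull {a, a + u, a + u + v, a + v} \<and>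
      c = midpoint a (a + u + v))"

definition square_pyramid :: "(real^3) set \<Rightarrow> bool" where
  "square_pyramid L \<longleftrightarrow>
    (\<exists>S c p. square_with_center S c \<and>
      p \<notin> affine hull S \<and> (\<forall>x\<in>affine hull S. orthogonal (p - c) (x - c)) \<and>
      L = convex hull (insert p S))"

end

theory Submission
  imports Defs "HOL-Computational_Algebra.Primes"
begin

(* Reliability: the facets of the pyramid other than the base come in two opposite pairs, and the
   normals of each pair span a plane together with the normal of the base.  A translation that works
   for one such plane still works, as far as the two sloping facets are concerned, when it is
   lowered; so one combines the horizontal components of the two translations with the smaller of
   the two vertical ones.

   Indecomposability: the extreme points of a direct Minkowski sum are exactly the sums of extreme
   points of the summands, so their numbers multiply.  The pyramid has 5 extreme points and 5 is
   prime, so all summands but one would be points and the pyramid would lie in a plane. *)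

section \<open>Projections\<close>

lemma inner_orth_proj:
  fixes \<xi> :: "'a::euclidean_space set"
  assumes "subspace \<xi>" "z \<in> \<xi>"
  shows "orth_proj \<xi> x \<bullet> z = x \<bullet> z"
proof -
  have "\<forall>z\<in>\<xi>. orthogonal (x - orth_proj \<xi> x) z"
    using theI'[OF ex1_orth_proj[OF assms(1), of x]] by (simp add: orth_proj_def)
  with assms(2) show ?thesis
    by (simp add: orthogonal_def inner_diff_left)
qed

text \<open>Pairing with vectors of \<xi> does not distinguish a point from its projection. So the
  hypothesis on projections turns into equations between inner products, and
  \<open>orth_proj\<close> disappears from the rest of the argument.\<close>

lemma contains_translate_orth_projD:
  fixes \<xi> :: "'a::euclidean_space set"
  assumes "subspace \<xi>" "contains_translate (orth_proj \<xi> ` L) (orth_proj \<xi> ` K)"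
  obtains w where "\<And>k. k \<in> K \<Longrightarrow> \<exists>l\<in>L. \<forall>z\<in>\<xi>. (w + k) \<bullet> z = l \<bullet> z"
proof -
  obtain w where w: "(\<lambda>x. w + x) ` orth_proj \<xi> ` K \<subseteq> orth_proj \<xi> ` L"
    using assms(2) by (auto simp: contains_translate_def)
  have "\<exists>l\<in>L. \<forall>z\<in>\<xi>. (w + k) \<bullet> z = l \<bullet> z" if k: "k \<in> K" for k
  proof -
    obtain l where l: "l \<in> L" "w + orth_proj \<xi> k = orth_proj \<xi> l"
      using w k by (metis (no_types, lifting) image_iff subsetD imageI)
    have "(w + k) \<bullet> z = l \<bullet> z" if "z \<in> \<xi>" for z
      using arg_cong[OF l(2), of "\<lambda>x. x \<bullet> z"] inner_orth_proj[OF assms(1) that]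
      by (simp add: inner_add_left)
    with l(1) show ?thesis by blast
  qed
  then show thesis by (rule that)
qed

section \<open>Direct Minkowski sums\<close>

lemma direct_sum_decomposition_eqD:
  assumes "direct_sum_decomposition m \<xi>"
    and "\<And>i. i < m \<Longrightarrow> f i \<in> \<xi> i" "\<And>i. i < m \<Longrightarrow> g i \<in> \<xi> i"
    and "(\<Sum>i<m. f i) = (\<Sum>i<m. g i)" "i < m"
  shows "f i = g i"
proof -
  have uniq: "\<exists>!h. h \<in> PiE {..<m} \<xi> \<and> (\<Sum>i<m. f i) = (\<Sum>i<m. h i)"
    using assms(1) unfolding direct_sum_decomposition_def by blast
  \<comment> \<open>Uniqueness holds only among functions that are undefined outside
    \<open>{..<m}\<close>, hence the restrictions.\<close>
  have "restrict f {..<m} \<in> PiE {..<m} \<xi> \<and> (\<Sum>i<m. f i) = (\<Sum>i<m. restrict f {..<m} i)"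
    "restrict g {..<m} \<in> PiE {..<m} \<xi> \<and> (\<Sum>i<m. f i) = (\<Sum>i<m. restrict g {..<m} i)"
    using assms(2-4) by simp_all
  with uniq have "restrict f {..<m} = restrict g {..<m}"
    by blast
  then show ?thesis
    using assms(5) by (metis lessThan_iff restrict_apply')
qed

text \<open>Directness allows a convex combination of sums to be read off in each component.
  Extremality of \<open>f i\<close> then forces the two endpoints to agree in every component, so
  the segment degenerates.\<close>

lemma sum_extreme_point_of_direct_sum:
  fixes M :: "nat \<Rightarrow> 'a::euclidean_space set"
  assumes dir: "direct_sum_decomposition m \<xi>" and sub: "\<And>i. i < m \<Longrightarrow> M i \<subseteq> \<xi> i"
    and f: "\<And>i. i < m \<Longrightarrow> f i extreme_point_of M i"
  shows "(\<Sum>i<m. f i) extreme_point_of (\<Sum>i<m. M i)"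
  unfolding extreme_point_of_def
proof (intro conjI ballI notI)
  have fM: "f i \<in> M i" if "i < m" for i
    using f[OF that] by (simp add: extreme_point_of_def)
  then show "(\<Sum>i<m. f i) \<in> (\<Sum>i<m. M i)"
    by (auto simp: set_sum_alt)
  fix x y assume xy: "x \<in> (\<Sum>i<m. M i)" "y \<in> (\<Sum>i<m. M i)" "(\<Sum>i<m. f i) \<in> open_segment x y"
  obtain g h where g: "x = (\<Sum>i<m. g i)" "\<And>i. i < m \<Longrightarrow> g i \<in> M i"
    and h: "y = (\<Sum>i<m. h i)" "\<And>i. i < m \<Longrightarrow> h i \<in> M i"
    using xy(1,2) by (force simp: set_sum_alt)
  obtain t where t: "x \<noteq> y" "0 < t" "t < 1" "(\<Sum>i<m. f i) = (1 - t) *\<^sub>R x + t *\<^sub>R y"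
    using xy(3) by (auto simp: in_segment)
  have sum: "(\<Sum>i<m. f i) = (\<Sum>i<m. (1 - t) *\<^sub>R g i + t *\<^sub>R h i)"
    by (simp add: t(4) g(1) h(1) scaleR_sum_right sum.distrib)
  have subsp: "subspace (\<xi> i)" if "i < m" for i
    using dir that by (simp add: direct_sum_decomposition_def)
  have comb: "f i = (1 - t) *\<^sub>R g i + t *\<^sub>R h i" if "i < m" for i
    by (rule direct_sum_decomposition_eqD[OF dir _ _ sum that])
      (use fM g(2) h(2) sub subsp in \<open>blast intro: subspace_add subspace_mul\<close>)+
  have "g i = h i" if "i < m" for i
  proof (rule ccontr)
    assume "g i \<noteq> h i"
    then have "f i \<in> open_segment (g i) (h i)"
      using comb[OF that] t by (auto simp: in_segment)
    then show False
      using f[OF that] g(2) h(2) that by (auto simp: extreme_point_of_def)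
  qed
  then show False
    using t(1) g(1) h(1) by simp
qed

text \<open>A segment in \<open>M i\<close> with \<open>f i\<close> in its interior, translated by
  the remaining summands of \<open>x\<close>, would be a segment in the Minkowski sum with
  \<open>x\<close> in its interior.\<close>

lemma extreme_point_of_sumE:
  fixes M :: "nat \<Rightarrow> 'a::euclidean_space set"
  assumes x: "x extreme_point_of (\<Sum>i<m. M i)"
  obtains f where "x = (\<Sum>i<m. f i)" "\<And>i. i < m \<Longrightarrow> f i extreme_point_of M i"
proof -
  obtain f where f: "x = (\<Sum>i<m. f i)" "\<And>i. i < m \<Longrightarrow> f i \<in> M i"
    using x by (force simp: set_sum_alt extreme_point_of_def)
  have "f i extreme_point_of M i" if i: "i < m" for i
    unfolding extreme_point_of_def
  proof (intro conjI ballI notI)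
    show "f i \<in> M i" using f(2) i .
    fix g h assume gh: "g \<in> M i" "h \<in> M i" "f i \<in> open_segment g h"
    obtain t where t: "g \<noteq> h" "0 < t" "t < 1" "f i = (1 - t) *\<^sub>R g + t *\<^sub>R h"
      using gh(3) by (auto simp: in_segment)
    define r where "r = (\<Sum>j\<in>{..<m} - {i}. f j)"
    have upd: "(\<Sum>j<m. (f(i := z)) j) = z + r" for z
      using i by (auto simp: r_def sum.remove[of _ i] intro!: sum.cong)
    have mem: "z + r \<in> (\<Sum>i<m. M i)" if "z \<in> M i" for z
      unfolding upd[symmetric] using f(2) that
      by (force simp: set_sum_alt intro!: exI[of _ "f(i := z)"])
    have "x = f i + r"
      using upd[of "f i"] f(1) by simp
    then have "x = (1 - t) *\<^sub>R (g + r) + t *\<^sub>R (h + r)"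
      by (simp add: t(4) algebra_simps)
    then have "x \<in> open_segment (g + r) (h + r)"
      using t by (auto simp: in_segment)
    then show False
      using x mem gh(1,2) by (auto simp: extreme_point_of_def)
  qed
  with f(1) show thesis by (rule that)
qed

text \<open>Summation is a bijection from families of extreme points of the summands onto the
  extreme points of the sum: directness gives injectivity, and the two preceding lemmas give the
  image.\<close>

lemma card_extreme_points_direct_sum:
  fixes M :: "nat \<Rightarrow> 'a::euclidean_space set"
  assumes dir: "direct_sum_decomposition m \<xi>" and sub: "\<And>i. i < m \<Longrightarrow> M i \<subseteq> \<xi> i"
  shows "card {x. x extreme_point_of (\<Sum>i<m. M i)} = (\<Prod>i<m. card {x. x extreme_point_of M i})"
proof -
  let ?E = "\<lambda>i. {x. x extreme_point_of M i}"
  have "bij_betw (\<lambda>f. \<Sum>i<m. f i) (PiE {..<m} ?E) {x. x extreme_point_of (\<Sum>i<m. M i)}"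
    unfolding bij_betw_def
  proof
    have E: "f i \<in> \<xi> i" if "f \<in> PiE {..<m} ?E" "i < m" for f i
      using PiE_mem[OF that(1), of i] that(2) sub by (auto simp: extreme_point_of_def)
    show "inj_on (\<lambda>f. \<Sum>i<m. f i) (PiE {..<m} ?E)"
    proof (rule inj_onI)
      fix f g assume fg: "f \<in> PiE {..<m} ?E" "g \<in> PiE {..<m} ?E" "(\<Sum>i<m. f i) = (\<Sum>i<m. g i)"
      show "f = g"
        by (rule PiE_ext[OF fg(1,2)])
          (use direct_sum_decomposition_eqD[OF dir E[OF fg(1)] E[OF fg(2)] fg(3)] in simp)
    qed
    show "(\<lambda>f. \<Sum>i<m. f i) ` (PiE {..<m} ?E) = {x. x extreme_point_of (\<Sum>i<m. M i)}"
    proof (intro equalityI subsetI)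
      fix x assume "x \<in> (\<lambda>f. \<Sum>i<m. f i) ` (PiE {..<m} ?E)"
      then show "x \<in> {x. x extreme_point_of (\<Sum>i<m. M i)}"
        using sum_extreme_point_of_direct_sum[OF dir sub] by fastforce
    next
      fix x assume "x \<in> {x. x extreme_point_of (\<Sum>i<m. M i)}"
      then obtain f where "x = (\<Sum>i<m. f i)" "\<And>i. i < m \<Longrightarrow> f i extreme_point_of M i"
        by (auto elim: extreme_point_of_sumE)
      then show "x \<in> (\<lambda>f. \<Sum>i<m. f i) ` (PiE {..<m} ?E)"
        by (intro image_eqI[of _ _ "restrict f {..<m}"]) auto
    qed
  qed
  then have "card {x. x extreme_point_of (\<Sum>i<m. M i)} = card (PiE {..<m} ?E)"
    by (simp add: bij_betw_same_card)
  then show ?thesis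
    by (simp add: card_PiE)
qed

text \<open>A prime product has a single factor different from 1, so \<open>L\<close> is a translate
  of one summand. Differences of points express that \<open>L\<close> lies in a translate of \<xi>
  without naming the translation vector.\<close>

lemma decomposable_prime_extreme_points:
  fixes L :: "'a::euclidean_space set"
  assumes "decomposable d L" "prime (card {x. x extreme_point_of L})"
  obtains \<xi> where "subspace \<xi>" "dim \<xi> \<le> d" "\<And>x y. x \<in> L \<Longrightarrow> y \<in> L \<Longrightarrow> x - y \<in> \<xi>"
proof -
  obtain m \<xi> M where dir: "direct_sum_decomposition m \<xi>"
    and M: "\<And>i. i < m \<Longrightarrow> dim (\<xi> i) \<le> d" "\<And>i. i < m \<Longrightarrow> compact_convex (M i)"
      "\<And>i. i < m \<Longrightarrow> M i \<subseteq> \<xi> i" and L: "L = (\<Sum>i<m. M i)"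
    using assms(1) unfolding decomposable_def by blast
  define q where "q = card {x. x extreme_point_of L}"
  define n where "n i = card {x. x extreme_point_of M i}" for i
  have q: "q = (\<Prod>i<m. n i)" "prime q"
    using card_extreme_points_direct_sum[OF dir M(3)] assms(2) by (simp_all add: L q_def n_def)
  then obtain j where j: "j < m" "q dvd n j"
    by (metis dvd_refl finite_lessThan lessThan_iff prime_dvd_prod_iff)
  have "q = n j * (\<Prod>i\<in>{..<m} - {j}. n i)"
    using q(1) j(1) by (simp add: prod.remove)
  moreover have "q > 0" using q(2) by (simp add: prime_gt_0_nat)
  \<comment> \<open>\<open>q\<close> and \<open>n j\<close> divide each other, hence are equal, and
    the positive factor cancels.\<close>
  ultimately have "(\<Prod>i\<in>{..<m} - {j}. n i) = 1"
    using j(2) by (metis dvd_antisym dvd_triv_left mult_cancel1 nat_mult_1_right not_gr_zero)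
  then have n1: "n i = 1" if "i < m" "i \<noteq> j" for i
    using that by (metis DiffI finite_Diff finite_lessThan lessThan_iff prod_eq_1_iff singletonD)
  have single: "\<exists>z. M i = {z}" if i: "i < m" "i \<noteq> j" for i
  proof -
    obtain z where "{x. x extreme_point_of M i} = {z}"
      using n1[OF i] unfolding n_def by (rule card_1_singletonE)
    \<comment> \<open>By Minkowski's theorem a compact convex set is the convex hull of its extreme
      points.\<close>
    then have "M i = convex hull {z}"
      using Krein_Milman_Minkowski[of "M i"] M(2)[OF i(1)] by (simp add: compact_convex_def)
    then show ?thesis by simp
  qed
  have sj: "subspace (\<xi> j)"
    using dir j(1) by (simp add: direct_sum_decomposition_def)
  have "x - y \<in> \<xi> j" if "x \<in> L" "y \<in> L" for x y
  proof -
    obtain f g where f: "x = (\<Sum>i<m. f i)" "\<And>i. i < m \<Longrightarrow> f i \<in> M i"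
      and g: "y = (\<Sum>i<m. g i)" "\<And>i. i < m \<Longrightarrow> g i \<in> M i"
      using \<open>x \<in> L\<close> \<open>y \<in> L\<close> by (force simp: set_sum_alt L)
    have "f i = g i" if "i < m" "i \<noteq> j" for i
      using single[OF that] f(2)[OF that(1)] g(2)[OF that(1)] by auto
    then have "(\<Sum>i\<in>{..<m} - {j}. f i) = (\<Sum>i\<in>{..<m} - {j}. g i)"
      by (intro sum.cong) auto
    then have "x - y = f j - g j"
      using j(1) by (simp add: f(1) g(1) sum.remove[of _ j])
    then show ?thesis
      using f(2) g(2) j(1) M(3) sj by (metis subsetD subspace_diff)
  qed
  with sj M(1)[OF j(1)] show thesis by (rule that)
qed

section \<open>Pyramids over a rectangle\<close>

text \<open>All vectors start at the centre \<open>c\<close> of the base: \<open>u\<close> and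
  \<open>v\<close> are half sides and \<open>e\<close> leads to the apex. In these coordinates the
  base vertices are (\<plusminus>1, \<plusminus>1, 0) and the apex is (0, 0, 1).\<close>

definition rect_pyramid :: "'a::euclidean_space \<Rightarrow> 'a \<Rightarrow> 'a \<Rightarrow> 'a \<Rightarrow> 'a set" where
  "rect_pyramid c u v e = convex hull {c + e, c + u + v, c + u - v, c - u + v, c - u - v}"

lemma square_pyramidE:
  assumes "square_pyramid L"
  obtains c u v e where "u \<noteq> 0" "v \<noteq> 0" "e \<noteq> 0" "u \<bullet> v = 0" "u \<bullet> e = 0" "v \<bullet> e = 0"
    "L = rect_pyramid c u v e"
proof -
  obtain a u v c p S where uv: "u \<noteq> 0" "norm u = norm v" "orthogonal u v"
    and S: "S = convex hull {a, a + u, a + u + v, a + v}" and c: "c = midpoint a (a + u + v)"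
    and p: "p \<notin> affine hull S" "\<And>x. x\<in>affine hull S \<Longrightarrow> orthogonal (p - c) (x - c)"
    and L: "L = convex hull (insert p S)"
    using assms unfolding square_pyramid_def square_with_center_def by blast
  have vert: "a \<in> S" "a + u \<in> S" "a + u + v \<in> S" "a + v \<in> S"
    unfolding S by (auto intro: hull_inc)
  \<comment> \<open>The centre is the midpoint of a diagonal.\<close>
  have "c \<in> S"
    using closed_segment_subset[OF vert(1,3)] by (auto simp: S c)
  then have "p \<noteq> c"
    using p(1) hull_subset[of S affine] by blast
  have c': "c = a + (1/2) *\<^sub>R u + (1/2) *\<^sub>R v"
    by (simp add: c midpoint_def vec_eq_iff field_simps)
  have orth: "(p - c) \<bullet> (x - c) = 0" if "x \<in> S" for x
    using p(2)[of x] that hull_inc[of x S affine] by (simp add: orthogonal_def)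
  \<comment> \<open>The sides \<open>u\<close> and \<open>v\<close> are differences of vertices, so
    orthogonality to the vertices relative to \<open>c\<close> passes to them.\<close>
  have pu: "(p - c) \<bullet> u = 0" "(p - c) \<bullet> v = 0"
    using orth[OF vert(1)] orth[OF vert(2)] orth[OF vert(4)]
    by (simp_all add: inner_diff_right inner_add_right)
  show thesis
  proof (rule that[of "(1/2) *\<^sub>R u" "(1/2) *\<^sub>R v" "p - c" c])
    show "L = rect_pyramid c ((1/2) *\<^sub>R u) ((1/2) *\<^sub>R v) (p - c)"
    proof -
      have h: "x = (1/2) *\<^sub>R x + (1/2) *\<^sub>R x" for x :: "real^3"
        by (simp only: field_sum_of_halves scaleR_one flip: scaleR_add_left)
      have "c + (1/2) *\<^sub>R u + (1/2) *\<^sub>R v = a + u + v" "c + (1/2) *\<^sub>R u - (1/2) *\<^sub>R v = a + u"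
        "c - (1/2) *\<^sub>R u + (1/2) *\<^sub>R v = a + v" "c - (1/2) *\<^sub>R u - (1/2) *\<^sub>R v = a"
        using h[of u] h[of v] by (simp_all add: c' algebra_simps)
      then show ?thesis
        unfolding L S rect_pyramid_def
        by (simp add: hull_insert[of _ p, symmetric] insert_commute)
    qed
  qed (use uv \<open>p \<noteq> c\<close> pu in \<open>auto simp: orthogonal_def inner_commute\<close>)
qed

section \<open>Coordinates and facet inequalities of the pyramid\<close>

lemma orthogonal_coordinates:
  fixes u v e x :: "real^3"
  assumes "u \<noteq> 0" "v \<noteq> 0" "e \<noteq> 0" "u \<bullet> v = 0" "u \<bullet> e = 0" "v \<bullet> e = 0"
  shows "x = (x \<bullet> u / (u \<bullet> u)) *\<^sub>R u + (x \<bullet> v / (v \<bullet> v)) *\<^sub>R v + (x \<bullet> e / (e \<bullet> e)) *\<^sub>R e"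
proof -
  have orth: "v \<bullet> u = 0" "e \<bullet> u = 0" "e \<bullet> v = 0"
    using assms by (simp_all add: inner_commute)
  have ne: "u \<noteq> v" "u \<noteq> e" "v \<noteq> e"
    using assms by auto
  have "pairwise orthogonal {u, v, e}"
    using assms by (auto simp: pairwise_def orthogonal_def inner_commute)
  then have "independent {u, v, e}"
    using assms by (intro pairwise_orthogonal_independent) auto
  moreover have "card {u, v, e} = 3"
    using ne by simp
  ultimately have span: "span {u, v, e} = UNIV"
    by (simp flip: dim_eq_full add: dim_eq_card_independent)
  \<comment> \<open>The remainder \<open>w\<close> is orthogonal to a spanning set, hence to itself,
    and so vanishes.\<close>
  define w where
    "w = x - ((x \<bullet> u / (u \<bullet> u)) *\<^sub>R u + (x \<bullet> v / (v \<bullet> v)) *\<^sub>R v + (x \<bullet> e / (e \<bullet> e)) *\<^sub>R e)"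
  have "orthogonal w z" if "z \<in> {u, v, e}" for z
    using that assms orth by (auto simp: w_def orthogonal_def inner_simps)
  then have "orthogonal w w"
    using orthogonal_to_span[of w "{u, v, e}" w] span by auto
  then show ?thesis
    by (simp add: orthogonal_self w_def)
qed

text \<open>The point is the convex combination of \<open>x + y\<close> and \<open>x - y\<close>
  with weights (1 + s)/2 and (1 - s)/2.\<close>

lemma convex_add_scaled:
  fixes H :: "'a::real_vector set"
  assumes "convex H" "x + y \<in> H" "x - y \<in> H" "\<bar>s\<bar> \<le> 1"
  shows "x + s *\<^sub>R y \<in> H"
proof -
  have "((1 + s) / 2) *\<^sub>R (x + y) + ((1 - s) / 2) *\<^sub>R (x - y) \<in> H"
    using assms by (intro convexD) (auto simp: abs_le_iff field_simps)
  also have "((1 + s) / 2) *\<^sub>R (x + y) + ((1 - s) / 2) *\<^sub>R (x - y)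
      = ((1 + s) / 2 + (1 - s) / 2) *\<^sub>R x + ((1 + s) / 2 - (1 - s) / 2) *\<^sub>R y"
    by (simp only: scaleR_add_left scaleR_diff_left scaleR_add_right scaleR_diff_right) simp
  also have "\<dots> = x + s *\<^sub>R y"
    by (simp add: field_simps)
  finally show ?thesis .
qed

text \<open>A point at height \<open>r\<close> below the apex divides a segment from a base point to
  the apex; the base point has coordinates \<open>s / (1 - r)\<close> and
  \<open>t / (1 - r)\<close>. At \<open>r = 1\<close> the bounds force \<open>s = t = 0\<close>,
  which is the apex itself.\<close>

lemma rect_pyramid_coordinates:
  fixes u v e :: "'a::euclidean_space"
  assumes "0 \<le> r" "\<bar>s\<bar> \<le> 1 - r" "\<bar>t\<bar> \<le> 1 - r"
  shows "c + s *\<^sub>R u + t *\<^sub>R v + r *\<^sub>R e \<in> rect_pyramid c u v e"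
proof (cases "r = 1")
  case True
  then show ?thesis
    using assms by (auto simp: rect_pyramid_def intro: hull_inc)
next
  case False
  then have r: "r < 1" using assms by linarith
  let ?H = "rect_pyramid c u v e"
  have cvx: "convex ?H" by (simp add: rect_pyramid_def)
  have V: "c + e \<in> ?H" "c + u + v \<in> ?H" "c + u - v \<in> ?H" "c - u + v \<in> ?H" "c - u - v \<in> ?H"
    unfolding rect_pyramid_def by (auto intro: hull_inc)
  define s' t' where "s' = s / (1 - r)" and "t' = t / (1 - r)"
  have st: "\<bar>s'\<bar> \<le> 1" "\<bar>t'\<bar> \<le> 1" "(1 - r) * s' = s" "(1 - r) * t' = t"
    using assms r by (auto simp: s'_def t'_def)
  \<comment> \<open>First move along the two base edges parallel to \<open>u\<close>, then across
    between them in direction \<open>v\<close>.\<close>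
  have "(c + v) + s' *\<^sub>R u \<in> ?H" "(c - v) + s' *\<^sub>R u \<in> ?H"
    by (rule convex_add_scaled[OF cvx _ _ st(1)]; use V in \<open>simp add: algebra_simps\<close>)+
  then have "(c + s' *\<^sub>R u) + t' *\<^sub>R v \<in> ?H"
    by (intro convex_add_scaled[OF cvx _ _ st(2)]) (simp_all add: algebra_simps)
  then have "(1 - r) *\<^sub>R (c + s' *\<^sub>R u + t' *\<^sub>R v) + r *\<^sub>R (c + e) \<in> ?H"
    using V(1) assms(1) r by (intro convexD[OF cvx]) auto
  also have "(1 - r) *\<^sub>R (c + s' *\<^sub>R u + t' *\<^sub>R v) + r *\<^sub>R (c + e)
      = c + ((1 - r) * s') *\<^sub>R u + ((1 - r) * t') *\<^sub>R v + r *\<^sub>R e"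
    by (simp add: algebra_simps)
  finally show ?thesis by (simp only: st)
qed

text \<open>Description by the base inequality and the four sloping facets. The right side is convex
  and contains the five vertices; conversely, its points have the coordinates treated in
  \<open>rect_pyramid_coordinates\<close>.\<close>

lemma rect_pyramid_eq:
  fixes c u v e :: "real^3"
  assumes "u \<noteq> 0" "v \<noteq> 0" "e \<noteq> 0" "u \<bullet> v = 0" "u \<bullet> e = 0" "v \<bullet> e = 0"
  shows "rect_pyramid c u v e = {x. 0 \<le> (x - c) \<bullet> e / (e \<bullet> e) \<and>
    \<bar>(x - c) \<bullet> u / (u \<bullet> u)\<bar> \<le> 1 - (x - c) \<bullet> e / (e \<bullet> e) \<and>
    \<bar>(x - c) \<bullet> v / (v \<bullet> v)\<bar> \<le> 1 - (x - c) \<bullet> e / (e \<bullet> e)}" (is "_ = ?R")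
proof
  have orth: "v \<bullet> u = 0" "e \<bullet> u = 0" "e \<bullet> v = 0"
    using assms by (simp_all add: inner_commute)
  have "convex ?R"
  proof (rule convexI)
    fix x y :: "real^3" and s t :: real
    assume xy: "x \<in> ?R" "y \<in> ?R" and st: "0 \<le> s" "0 \<le> t" "s + t = 1"
    \<comment> \<open>Each coordinate is an affine function of the point because
      \<open>s + t = 1\<close>.\<close>
    have comb: "(s *\<^sub>R x + t *\<^sub>R y - c) \<bullet> w / k = s * ((x - c) \<bullet> w / k) + t * ((y - c) \<bullet> w / k)"
      for w k
    proof -
      have "c \<bullet> w = s * (c \<bullet> w) + t * (c \<bullet> w)"
        using st(3) by (metis distrib_right mult_1)
      then show ?thesis
        by (simp add: inner_diff_left inner_add_left algebra_simps
            flip: add_divide_distrib diff_divide_distrib)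
    qed
    have bound: "\<bar>s * a + t * b\<bar> \<le> 1 - (s * a' + t * b')"
      if "\<bar>a\<bar> \<le> 1 - a'" "\<bar>b\<bar> \<le> 1 - b'" for a b a' b' :: real
    proof -
      have "\<bar>s * a + t * b\<bar> \<le> s * \<bar>a\<bar> + t * \<bar>b\<bar>"
        using st by (metis abs_mult abs_of_nonneg abs_triangle_ineq)
      also have "\<dots> \<le> s * (1 - a') + t * (1 - b')"
        using that st by (intro add_mono mult_left_mono) auto
      also have "\<dots> = 1 - (s * a' + t * b')"
        using st(3) by (simp add: algebra_simps)
      finally show ?thesis .
    qed
    from xy show "s *\<^sub>R x + t *\<^sub>R y \<in> ?R"
      unfolding mem_Collect_eq comb using st by (intro conjI bound add_nonneg_nonneg mult_nonneg_nonneg) auto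
  qed
  moreover have "{c + e, c + u + v, c + u - v, c - u + v, c - u - v} \<subseteq> ?R"
    using assms orth by (auto simp: inner_simps)
  ultimately show "rect_pyramid c u v e \<subseteq> ?R"
    unfolding rect_pyramid_def by (intro hull_minimal)
next
  show "?R \<subseteq> rect_pyramid c u v e"
  proof
    fix x assume "x \<in> ?R"
    then have "c + ((x - c) \<bullet> u / (u \<bullet> u)) *\<^sub>R u + ((x - c) \<bullet> v / (v \<bullet> v)) *\<^sub>R v
        + ((x - c) \<bullet> e / (e \<bullet> e)) *\<^sub>R e \<in> rect_pyramid c u v e"
      by (intro rect_pyramid_coordinates) auto
    also have "c + ((x - c) \<bullet> u / (u \<bullet> u)) *\<^sub>R u + ((x - c) \<bullet> v / (v \<bullet> v)) *\<^sub>R v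
        + ((x - c) \<bullet> e / (e \<bullet> e)) *\<^sub>R e = x"
      using orthogonal_coordinates[OF assms, of "x - c"] by (simp add: algebra_simps)
    finally show "x \<in> rect_pyramid c u v e" .
  qed
qed

section \<open>Reliability of the pyramid\<close>

lemma dim_span_orthogonal_pair:
  fixes u e :: "'a::euclidean_space"
  assumes "u \<noteq> 0" "e \<noteq> 0" "u \<bullet> e = 0"
  shows "dim (span {u, e}) = 2"
proof -
  have "pairwise orthogonal {u, e}"
    using assms by (auto simp: pairwise_def orthogonal_def inner_commute)
  then have "independent {u, e}"
    using assms by (intro pairwise_orthogonal_independent) auto
  moreover have "u \<noteq> e" using assms by auto
  ultimately show ?thesis
    by (simp add: dim_eq_card_independent)
qed

lemma reliable_rect_pyramid:
  fixes c u v e :: "real^3"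
  assumes "u \<noteq> 0" "v \<noteq> 0" "e \<noteq> 0" "u \<bullet> v = 0" "u \<bullet> e = 0" "v \<bullet> e = 0"
  shows "reliable 2 (rect_pyramid c u v e)"
  unfolding reliable_def
proof (intro conjI allI impI)
  let ?L = "rect_pyramid c u v e"
  have orth: "v \<bullet> u = 0" "e \<bullet> u = 0" "e \<bullet> v = 0"
    using assms by (simp_all add: inner_commute)
  show "compact_convex ?L"
    by (auto simp: compact_convex_def rect_pyramid_def intro!: finite_imp_compact_convex_hull)
  fix K :: "(real^3) set"
  assume *: "\<forall>\<xi>. subspace \<xi> \<and> dim \<xi> = 2 \<longrightarrow>
    contains_translate (orth_proj \<xi> ` ?L) (orth_proj \<xi> ` K)"
  \<comment> \<open>The hypothesis is applied to the plane spanned by \<open>z\<close> and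
    \<open>e\<close>, later with \<open>z\<close> equal to \<open>u\<close> or
    \<open>v\<close>.\<close>
  have ex: "\<exists>w. \<forall>k\<in>K. \<exists>l\<in>?L. (w + k) \<bullet> z = l \<bullet> z \<and> (w + k) \<bullet> e = l \<bullet> e"
    if "z \<noteq> 0" "z \<bullet> e = 0" for z
  proof -
    have "contains_translate (orth_proj (span {z, e}) ` ?L) (orth_proj (span {z, e}) ` K)"
      using * dim_span_orthogonal_pair[of z e] that assms(3) by blast
    then obtain w where
      "\<And>k. k \<in> K \<Longrightarrow> \<exists>l\<in>?L. \<forall>y\<in>span {z, e}. (w + k) \<bullet> y = l \<bullet> y"
      using contains_translate_orth_projD[OF subspace_span] by blast
    moreover have "z \<in> span {z, e}" "e \<in> span {z, e}"
      by (auto intro: span_base)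
    ultimately show ?thesis by blast
  qed
  obtain w1 where w1: "\<And>k. k \<in> K \<Longrightarrow> \<exists>l\<in>?L. (w1 + k) \<bullet> u = l \<bullet> u \<and> (w1 + k) \<bullet> e = l \<bullet> e"
    using ex[of u] assms by blast
  obtain w2 where w2: "\<And>k. k \<in> K \<Longrightarrow> \<exists>l\<in>?L. (w2 + k) \<bullet> v = l \<bullet> v \<and> (w2 + k) \<bullet> e = l \<bullet> e"
    using ex[of v] assms by blast
  define w where "w = (w1 \<bullet> u / (u \<bullet> u)) *\<^sub>R u + (w2 \<bullet> v / (v \<bullet> v)) *\<^sub>R v
    + (min (w1 \<bullet> e) (w2 \<bullet> e) / (e \<bullet> e)) *\<^sub>R e"
  have w: "w \<bullet> u = w1 \<bullet> u" "w \<bullet> v = w2 \<bullet> v" "w \<bullet> e = min (w1 \<bullet> e) (w2 \<bullet> e)"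
    using assms orth by (simp_all add: w_def inner_simps)
  have "w + k \<in> ?L" if k: "k \<in> K" for k
  proof -
    obtain l1 where l1: "l1 \<in> ?L" "(w1 + k) \<bullet> u = l1 \<bullet> u" "(w1 + k) \<bullet> e = l1 \<bullet> e"
      using w1[OF k] by blast
    obtain l2 where l2: "l2 \<in> ?L" "(w2 + k) \<bullet> v = l2 \<bullet> v" "(w2 + k) \<bullet> e = l2 \<bullet> e"
      using w2[OF k] by blast
    have u: "(w + k - c) \<bullet> u = (l1 - c) \<bullet> u" and v: "(w + k - c) \<bullet> v = (l2 - c) \<bullet> v"
      using l1(2) l2(2) w by (simp_all add: inner_diff_left inner_add_left)
    have "(w + k - c) \<bullet> e = min ((l1 - c) \<bullet> e) ((l2 - c) \<bullet> e)"
      using l1(3) l2(3) w by (simp add: inner_diff_left inner_add_left)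
    then have e: "(w + k - c) \<bullet> e / (e \<bullet> e)
        = min ((l1 - c) \<bullet> e / (e \<bullet> e)) ((l2 - c) \<bullet> e / (e \<bullet> e))"
      using min_divide_distrib_right[of _ _ "e \<bullet> e"] by simp
    \<comment> \<open>The smaller height is still nonnegative, as \<open>l1\<close> and
      \<open>l2\<close> both lie above the base. The bounds on the \<open>u\<close> and
      \<open>v\<close> coordinates, taken from \<open>l1\<close> and \<open>l2\<close>, only relax
      when the height drops.\<close>
    show ?thesis
      using l1(1) l2(1) unfolding rect_pyramid_eq[OF assms] mem_Collect_eq u v e by linarith
  qed
  then show "contains_translate ?L K"
    by (auto simp: contains_translate_def)
qed

section \<open>Extreme points and indecomposability\<close>

lemma card_extreme_points_rect_pyramid:
  fixes c u v e :: "'a::euclidean_space"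
  assumes "u \<noteq> 0" "v \<noteq> 0" "e \<noteq> 0" "u \<bullet> v = 0" "u \<bullet> e = 0" "v \<bullet> e = 0"
  shows "card {x. x extreme_point_of rect_pyramid c u v e} = 5"
proof -
  let ?V = "{c + e, c + u + v, c + u - v, c - u + v, c - u - v}"
  have pos: "u \<bullet> u > 0" "v \<bullet> v > 0" "e \<bullet> e > 0"
    using assms by auto
  have orth: "v \<bullet> u = 0" "e \<bullet> u = 0" "e \<bullet> v = 0"
    using assms by (simp_all add: inner_commute)
  \<comment> \<open>\<open>f s t\<close> is the horizontal vector with prescribed products
    \<open>s\<close> and \<open>t\<close> with \<open>u\<close> and \<open>v\<close>; it serves as a
    separating functional.\<close>
  define f where "f s t = (s / (u \<bullet> u)) *\<^sub>R u + (t / (v \<bullet> v)) *\<^sub>R v" for s t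
  have f: "f s t \<bullet> u = s" "f s t \<bullet> v = t" "f s t \<bullet> e = 0" for s t
    using assms orth by (simp_all add: f_def inner_add_left)
  have sep: "x \<notin> convex hull A" if "d \<bullet> (x - c) < 0" "\<And>y. y \<in> A \<Longrightarrow> 0 \<le> d \<bullet> (y - c)" for x d A
  proof -
    have "convex hull A \<subseteq> {y. d \<bullet> c \<le> d \<bullet> y}"
      using that(2) by (intro hull_minimal) (auto simp: convex_halfspace_ge inner_diff_right)
    with that(1) show ?thesis by (auto simp: inner_diff_right)
  qed
  \<comment> \<open>Relative to \<open>c\<close>, the functional \<open>- e\<close> is negative at
    the apex and zero on the base.\<close>
  have "c + e \<notin> convex hull (?V - {c + e})"
    by (rule sep[of "- e"]) (use assms pos orth in \<open>auto simp: inner_simps\<close>)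
  \<comment> \<open>The functional is -2 at this vertex, 0 at its two neighbours in the base and at
    the apex, and 2 at the opposite vertex. The other base vertices follow by changing
    signs.\<close>
  moreover have "c + u + v \<notin> convex hull (?V - {c + u + v})"
    by (rule sep[of "f (-1) (-1)"]) (auto simp: inner_add_right inner_diff_right f)
  moreover have "c + u - v \<notin> convex hull (?V - {c + u - v})"
    by (rule sep[of "f (-1) 1"]) (auto simp: inner_add_right inner_diff_right f)
  moreover have "c - u + v \<notin> convex hull (?V - {c - u + v})"
    by (rule sep[of "f 1 (-1)"]) (auto simp: inner_add_right inner_diff_right f)
  moreover have "c - u - v \<notin> convex hull (?V - {c - u - v})"
    by (rule sep[of "f 1 1"]) (auto simp: inner_add_right inner_diff_right f)
  ultimately have "x \<notin> convex hull (?V - {x})" if "x \<in> ?V" for x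
    using that by (elim insertE emptyE) simp_all
  then have "{x. x extreme_point_of rect_pyramid c u v e} = ?V"
    unfolding rect_pyramid_def
    using extreme_point_of_convex_hull_convex_independent[of ?V]
    by (auto simp: finite_imp_compact)
  moreover have "card ?V = 5"
  proof -
    \<comment> \<open>Distinctness of the five vertices is detected by products with
      \<open>u\<close>, \<open>v\<close> or \<open>e\<close>.\<close>
    have "x \<noteq> y" if "d \<bullet> x \<noteq> d \<bullet> y" for x y d :: 'a
      using that by blast
    note neq = this[of u] this[of v] this[of e]
    have "c + e \<noteq> c + u + v" "c + e \<noteq> c + u - v" "c + e \<noteq> c - u + v" "c + e \<noteq> c - u - v"
      by (rule neq(3), use assms orth in \<open>simp add: inner_simps\<close>)+
    moreover have "c + u + v \<noteq> c - u + v" "c + u + v \<noteq> c - u - v" "c + u - v \<noteq> c - u + v"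
      "c + u - v \<noteq> c - u - v"
      by (rule neq(1), use assms in \<open>simp add: inner_simps\<close>)+
    moreover have "c + u + v \<noteq> c + u - v" "c - u + v \<noteq> c - u - v"
      by (rule neq(2), use assms orth in \<open>simp add: inner_simps\<close>)+
    ultimately show ?thesis
      by (simp only: card_insert_if finite_insert finite.emptyI insert_iff empty_iff) simp
  qed
  ultimately show ?thesis by simp
qed

lemma not_decomposable_rect_pyramid:
  fixes c u v e :: "real^3"
  assumes "u \<noteq> 0" "v \<noteq> 0" "e \<noteq> 0" "u \<bullet> v = 0" "u \<bullet> e = 0" "v \<bullet> e = 0"
  shows "\<not> decomposable 2 (rect_pyramid c u v e)"
proof
  assume "decomposable 2 (rect_pyramid c u v e)"
  moreover have "prime (card {x. x extreme_point_of rect_pyramid c u v e})"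
    by (simp add: card_extreme_points_rect_pyramid[OF assms])
  ultimately obtain \<xi> where \<xi>: "subspace \<xi>" "dim \<xi> \<le> 2"
    "\<And>x y. x \<in> rect_pyramid c u v e \<Longrightarrow> y \<in> rect_pyramid c u v e \<Longrightarrow> x - y \<in> \<xi>"
    using decomposable_prime_extreme_points by blast
  have orth: "v \<bullet> u = 0" "e \<bullet> u = 0" "e \<bullet> v = 0"
    using assms by (simp_all add: inner_commute)
  \<comment> \<open>Subtracting \<open>c\<close> from the other three points puts \<open>u\<close>,
    \<open>v\<close> and \<open>e\<close> in \<xi>, which is then the whole space and has dimension
    3.\<close>
  have "c \<in> rect_pyramid c u v e" "c + u \<in> rect_pyramid c u v e"
    "c + v \<in> rect_pyramid c u v e" "c + e \<in> rect_pyramid c u v e"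
    using assms orth by (simp_all add: rect_pyramid_eq)
  from \<xi>(3)[OF this(2,1)] \<xi>(3)[OF this(3,1)] \<xi>(3)[OF this(4,1)]
  have "u \<in> \<xi>" "v \<in> \<xi>" "e \<in> \<xi>" by auto
  then have "x \<in> \<xi>" for x
    by (subst orthogonal_coordinates[OF assms, of x])
      (intro subspace_add[OF \<xi>(1)] subspace_mul[OF \<xi>(1)])
  then have "\<xi> = UNIV" by blast
  with \<xi>(2) show False by simp
qed

theorem mainTheorem8:
  fixes L :: "(real^3) set"
  assumes "square_pyramid L"
  shows "reliable 2 L \<and> \<not> decomposable 2 L"
  using assms by (rule square_pyramidE) (simp add: reliable_rect_pyramid not_decomposable_rect_pyramid)

end
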